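(* A monoid monomorphism $m\colon M\to A$ (where $m(M)$ is identified with $M$, so that $M$ is a submonoid of $A$) is a normal subobject if one, and so all, of the following equivalent conditions is satisfied: (a) $M$ is the zero-class of some congruence; (b) $M$ is the zero-class of its syntactic congruence; (c) $M$ is the zero-class of the congruence $E(m)$; (d) $M$ is the zero-class of the smallest congruence whose zero-class contains $M$; (e) $m$ belongs to $\mathbf{Fix}(\eta_E)$, that is, $m$ is normal with respect to $\mathbf{Eq}(\mathbf{Mon})$; (f) $E(m)$ belongs to $\mathbf{Fix}(\varepsilon_E)$; (g) for every $x,y\in A$ and every $u\in M$, $xy\in M\Leftrightarrow xuy\in M$; (h) for every natural numbers $m,n\in\mathbb{N}$ and every double indexed sequences $a_{ij}\in A$, $u_{ij},v_{ij}\in M$, with $i=1,\ldots,m$ and $j=1,\ldots,n$, if $$0=a_{11}+v_{11}+\ldots+a_{1n}+v_{1n}$$ and $$\begin{aligned} a_{11}+u_{11}+\ldots+a_{1n}+u_{1n}&=a_{21}+v_{21}+\ldots+a_{2n}+v_{2n}\\ &\;\;\vdots\\ a_{(i-1)1}+u_{(i-1)1}+\ldots+a_{(i-1)n}+u_{(i-1)n}&=a_{i1}+v_{i1}+\ldots+a_{in}+v_{in}\\ &\;\;\vdots\\ a_{(m-1)1}+u_{(m-1)1}+\ldots+a_{(m-1)n}+u_{(m-1)n}&=a_{m1}+v_{m1}+\ldots+a_{mn}+v_{mn} \end{aligned}$$ then $$a_{m1}+u_{m1}+\ldots+a_{mn}+u_{mn}\in M.$$ (In (h) the letter $m$ denotes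 a natural number, not the monomorphism.)
   Context: Monoids are not assumed commutative. The operation of $A$ is written multiplicatively with unit $1$, except in (h), where the same operation is written additively with unit $0$. A congruence on a monoid $A$ is an equivalence relation on $A$ that is a submonoid of $A\times A$. The zero-class of a relation $S$ on $A$ is $[1]_S=\{u\in A\mid (1,u)\in S\}$. The syntactic congruence $\sim_M$ of $M$ is defined by: $a\sim_M b$ if for every $x,y\in A$, $xay\in M\Leftrightarrow xby\in M$. $E(m)$ is the smallest congruence on $A$ whose zero-class contains $M$; it is the transitive closure of the submonoid of $A\times A$ generated by $(M\times M)\cup\Delta_A$, where $\Delta_A$ is the diagonal. $\mathbf{Mon}$ is the category of monoids. $\mathbf{Eq}(\mathbf{Mon})$ has as objects pairs $(A,S)$ with $S$ a congruence on the monoid $A$, and as morphisms the monoid homomorphisms preserving the relations. $\mathbf{Mono}(\mathbf{Mon})$ has as objects the monoid monomorphisms and as morphisms the commutative squares. The normalization functor $N\colon\mathbf{Eq}(\mathbf{Mon})\to\mathbf{Mono}(\mathbf{Mon})$ sends $(A,S)$ to the inclusion $[1]_S\to A$. The functor $E\colon\mathbf{Mono}(\mathbf{Mon})\to\mathbf{Eq}(\mathbf{Mon})$, sending $m$ to $A$ equipped with $E(m)$, is left adjoint to $N$, with unit $\eta_E$ and counit $\varepsilon_E$. $\mathbf{Fix}(\eta_E)$ is the full subcategory of $\mathbf{Mono}(\mathbf{Mon})$ of those $m$ for which the unit component $m\to N(E(m))$ is an isomorphism, and $\mathbf{Fix}(\varepsilon_E)$ is the full subcategory of $\mathbf{Eq}(\mathbf{Mon})$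 of those $(A,S)$ for which the counit component $E(N(A,S))\to(A,S)$ is an isomorphism, i.e. those congruences that are generated by their zero-class (the smallest ones with that zero-class). A monomorphism $m\colon M\to A$ is normal with respect to $\mathbf{Eq}(\mathbf{Mon})$ if it is the pullback of some congruence $r\colon S\to A\times A$ on $A$ along $\langle 0,1\rangle\colon A\to A\times A$, $a\mapsto(1,a)$.
   Formalization: In (f), the condition that M is the zero-class of E(m) is added, since E(m) belongs to Fix(ε_E) for every monomorphism m; e.g. for M = N in A = (Z,+) the literal (f) holds but (a) fails. *)

theory Defs
  imports "HOL-Algebra.Group" "HOL.Hull"
begin

text \<open>
  Library \<open>hom\<close> does not require preservation of the unit, which is not automatic for monoids.
  The monomorphisms of the category of monoids are exactly the injective homomorphisms.
\<close>

definition monoid_hom :: "('a, 'c) monoid_scheme \<Rightarrow> ('b, 'd) monoid_scheme \<Rightarrow> ('a \<Rightarrow> 'b) \<Rightarrow> bool" where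
  "monoid_hom G H f \<longleftrightarrow> f \<in> hom G H \<and> f \<one>\<^bsub>G\<^esub> = \<one>\<^bsub>H\<^esub>"

definition monoid_mono :: "('a, 'c) monoid_scheme \<Rightarrow> ('b, 'd) monoid_scheme \<Rightarrow> ('a \<Rightarrow> 'b) \<Rightarrow> bool" where
  "monoid_mono G H f \<longleftrightarrow> monoid_hom G H f \<and> inj_on f (carrier G)"

section \<open>Congruences\<close>

definition congruence :: "'a monoid \<Rightarrow> 'a rel \<Rightarrow> bool" where
  "congruence A S \<longleftrightarrow> equiv (carrier A) S \<and> submonoid S (A \<times>\<times> A)"

definition zero_cls :: "'a monoid \<Rightarrow> 'a rel \<Rightarrow> 'a set" where
  "zero_cls A S = {u \<in> carrier A. (\<one>\<^bsub>A\<^esub>, u) \<in> S}"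

definition syntactic_congruence :: "'a monoid \<Rightarrow> 'a set \<Rightarrow> 'a rel" where
  "syntactic_congruence A M = {(a, b) \<in> carrier A \<times> carrier A.
     \<forall>x \<in> carrier A. \<forall>y \<in> carrier A.
       x \<otimes>\<^bsub>A\<^esub> a \<otimes>\<^bsub>A\<^esub> y \<in> M \<longleftrightarrow> x \<otimes>\<^bsub>A\<^esub> b \<otimes>\<^bsub>A\<^esub> y \<in> M}"

definition E_gen :: "'a monoid \<Rightarrow> 'a set \<Rightarrow> 'a rel" where
  "E_gen A M = (\<lambda>K. submonoid K (A \<times>\<times> A)) hull (M \<times> M \<union> Id_on (carrier A))"

definition E_rel :: "'a monoid \<Rightarrow> 'a set \<Rightarrow> 'a rel" where
  "E_rel A M = (E_gen A M)\<^sup>+"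

lemma E_gen_submonoid:
  assumes "monoid A" "I \<subseteq> carrier A"
  shows "submonoid (E_gen A I) (A \<times>\<times> A)"
proof -
  have top: "submonoid (carrier A \<times> carrier A) (A \<times>\<times> A)"
    using assms(1) by unfold_locales (auto simp: monoid.m_closed)
  show ?thesis
    unfolding E_gen_def hull_def
  proof
    show "\<Inter> {t. submonoid t (A \<times>\<times> A) \<and> I \<times> I \<union> Id_on (carrier A) \<subseteq> t} \<subseteq> carrier (A \<times>\<times> A)"
      using top assms(2) by auto
  qed (auto intro: submonoid.m_closed submonoid.one_closed simp del: mult_DirProd one_DirProd)
qed

lemma E_gen_subset: "submonoid K (A \<times>\<times> A) \<Longrightarrow> I \<times> I \<union> Id_on (carrier A) \<subseteq> K \<Longrightarrow> E_gen A I \<subseteq> K"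
  unfolding E_gen_def by (rule hull_minimal)

lemma E_gen_refl: "x \<in> carrier A \<Longrightarrow> (x, x) \<in> E_gen A I"
  unfolding E_gen_def by (rule hull_inc) auto

lemma E_gen_sym:
  assumes "monoid A" "I \<subseteq> carrier A"
  shows "sym (E_gen A I)"
proof -
  interpret submonoid "E_gen A I" "A \<times>\<times> A"
    by (rule E_gen_submonoid[OF assms])
  have "submonoid ((E_gen A I)\<inverse>) (A \<times>\<times> A)"
  proof
    show "(E_gen A I)\<inverse> \<subseteq> carrier (A \<times>\<times> A)" using subset by auto
    show "x \<otimes>\<^bsub>A \<times>\<times> A\<^esub> y \<in> (E_gen A I)\<inverse>" if "x \<in> (E_gen A I)\<inverse>" "y \<in> (E_gen A I)\<inverse>" for x y
      using that m_closed[of "prod.swap x" "prod.swap y"] by (cases x; cases y) simp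
    show "\<one>\<^bsub>A \<times>\<times> A\<^esub> \<in> (E_gen A I)\<inverse>" using one_closed by simp
  qed
  moreover have "I \<times> I \<union> Id_on (carrier A) \<subseteq> (E_gen A I)\<inverse>"
    using hull_subset[of "I \<times> I \<union> Id_on (carrier A)" "\<lambda>K. submonoid K (A \<times>\<times> A)"]
    unfolding E_gen_def by auto
  ultimately have "E_gen A I \<subseteq> (E_gen A I)\<inverse>" by (rule E_gen_subset)
  then show ?thesis by (auto simp: sym_def)
qed

text \<open>\<open>E_rel\<close> is the smallest congruence whose zero-class contains the given submonoid.\<close>

lemma E_rel_congruence:
  assumes A: "monoid A" and I: "I \<subseteq> carrier A"
  shows "congruence A (E_rel A I)"
proof -
  interpret A: monoid A by (rule A)
  interpret K: submonoid "E_gen A I" "A \<times>\<times> A"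
    by (rule E_gen_submonoid[OF A I])
  have sub: "E_rel A I \<subseteq> carrier A \<times> carrier A"
    unfolding E_rel_def using K.subset by (intro trancl_subset_Sigma) auto
  have l: "(c \<otimes>\<^bsub>A\<^esub> a, c \<otimes>\<^bsub>A\<^esub> b) \<in> E_rel A I" if "(a, b) \<in> E_rel A I" "c \<in> carrier A" for a b c
    using that(1) unfolding E_rel_def
  proof (induction rule: trancl_induct)
    case (base y)
    show ?case using K.m_closed[OF E_gen_refl[OF that(2)] base] by auto
  next
    case (step y z)
    show ?case
      using trancl_into_trancl[OF step(3)] K.m_closed[OF E_gen_refl[OF that(2)] step(2)] by simp
  qed
  have r: "(a \<otimes>\<^bsub>A\<^esub> c, b \<otimes>\<^bsub>A\<^esub> c) \<in> E_rel A I" if "(a, b) \<in> E_rel A I" "c \<in> carrier A" for a b c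
    using that(1) unfolding E_rel_def
  proof (induction rule: trancl_induct)
    case (base y)
    show ?case using K.m_closed[OF base E_gen_refl[OF that(2)]] by auto
  next
    case (step y z)
    show ?case
      using trancl_into_trancl[OF step(3)] K.m_closed[OF step(2) E_gen_refl[OF that(2)]] by simp
  qed
  have tr: "trans (E_rel A I)" unfolding E_rel_def by simp
  have rf: "(x, x) \<in> E_rel A I" if "x \<in> carrier A" for x
    unfolding E_rel_def using E_gen_refl[OF that] by blast
  have "equiv (carrier A) (E_rel A I)"
    using sub tr rf E_gen_sym[OF A I] unfolding E_rel_def
    by (auto intro!: equivI refl_onI sym_trancl)
  moreover have "submonoid (E_rel A I) (A \<times>\<times> A)"
  proof
    show "E_rel A I \<subseteq> carrier (A \<times>\<times> A)" using sub by simp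
    show "\<one>\<^bsub>A \<times>\<times> A\<^esub> \<in> E_rel A I" using rf by simp
    show "x \<otimes>\<^bsub>A \<times>\<times> A\<^esub> y \<in> E_rel A I" if "x \<in> E_rel A I" "y \<in> E_rel A I" for x y
    proof (cases x; cases y)
      fix a b c d assume eq: "x = (a, b)" "y = (c, d)"
      have "(a \<otimes>\<^bsub>A\<^esub> c, b \<otimes>\<^bsub>A\<^esub> c) \<in> E_rel A I" "(b \<otimes>\<^bsub>A\<^esub> c, b \<otimes>\<^bsub>A\<^esub> d) \<in> E_rel A I"
        using that eq sub l r by auto
      then show ?thesis using tr eq by (auto dest: transD)
    qed
  qed
  ultimately show ?thesis by (simp add: congruence_def)
qed

lemma E_rel_zero_cls:
  assumes "I \<subseteq> carrier A" "\<one>\<^bsub>A\<^esub> \<in> I"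
  shows "I \<subseteq> zero_cls A (E_rel A I)"
proof
  fix u assume u: "u \<in> I"
  have "(\<one>\<^bsub>A\<^esub>, u) \<in> E_gen A I"
    unfolding E_gen_def using u assms(2) by (intro hull_inc) auto
  then show "u \<in> zero_cls A (E_rel A I)"
    using u assms(1) by (auto simp: zero_cls_def E_rel_def)
qed

lemma E_rel_least:
  assumes "congruence A S" "I \<subseteq> zero_cls A S"
  shows "E_rel A I \<subseteq> S"
proof -
  from assms(1) have eq: "equiv (carrier A) S" and sub: "submonoid S (A \<times>\<times> A)"
    by (auto simp: congruence_def)
  from eq have tr: "trans S" and sy: "sym S" and rf: "refl_on (carrier A) S"
    by (auto simp: equiv_def)
  have "(x, y) \<in> S" if "x \<in> I" "y \<in> I" for x y
  proof -
    have "(\<one>\<^bsub>A\<^esub>, x) \<in> S" "(\<one>\<^bsub>A\<^esub>, y) \<in> S" using that assms(2) by (auto simp: zero_cls_def)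
    then show ?thesis using tr sy by (meson symD transD)
  qed
  then have "I \<times> I \<union> Id_on (carrier A) \<subseteq> S" using rf by (auto intro: refl_onD)
  from E_gen_subset[OF sub this] have "(E_gen A I)\<^sup>+ \<subseteq> S\<^sup>+" by (meson subsetI trancl_mono)
  then show ?thesis unfolding E_rel_def using tr by simp
qed

section \<open>The categories \<open>Eq(Mon)\<close> and \<open>Mono(Mon)\<close>\<close>

text \<open>Morphisms are functions on carriers, so equality of morphisms is equality on the carrier.\<close>

type_synonym 'a eq_ob = "'a monoid \<times> 'a rel"

type_synonym ('b, 'a) mono_ob = "'b monoid \<times> 'a monoid \<times> ('b \<Rightarrow> 'a)"

definition eq_obj :: "'a eq_ob \<Rightarrow> bool" where
  "eq_obj = (\<lambda>(A, S). monoid A \<and> congruence A S)"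

definition eq_mor :: "'a eq_ob \<Rightarrow> 'b eq_ob \<Rightarrow> ('a \<Rightarrow> 'b) \<Rightarrow> bool" where
  "eq_mor = (\<lambda>(A, S) (B, T) f. monoid_hom A B f \<and> (\<forall>(x, y) \<in> S. (f x, f y) \<in> T))"

definition eq_iso :: "'a eq_ob \<Rightarrow> 'b eq_ob \<Rightarrow> ('a \<Rightarrow> 'b) \<Rightarrow> bool" where
  "eq_iso X Y f \<longleftrightarrow> eq_mor X Y f \<and>
     (\<exists>g. eq_mor Y X g \<and> (\<forall>x \<in> carrier (fst X). g (f x) = x) \<and> (\<forall>y \<in> carrier (fst Y). f (g y) = y))"

definition mono_obj :: "('b, 'a) mono_ob \<Rightarrow> bool" where
  "mono_obj = (\<lambda>(M, A, m). monoid M \<and> monoid A \<and> monoid_mono M A m)"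

definition mono_mor ::
  "('b, 'a) mono_ob \<Rightarrow> ('d, 'c) mono_ob \<Rightarrow> ('b \<Rightarrow> 'd) \<times> ('a \<Rightarrow> 'c) \<Rightarrow> bool" where
  "mono_mor = (\<lambda>(M, A, m) (M', A', m') (f, g).
     monoid_hom M M' f \<and> monoid_hom A A' g \<and> (\<forall>x \<in> carrier M. g (m x) = m' (f x)))"

definition mono_iso ::
  "('b, 'a) mono_ob \<Rightarrow> ('d, 'c) mono_ob \<Rightarrow> ('b \<Rightarrow> 'd) \<times> ('a \<Rightarrow> 'c) \<Rightarrow> bool" where
  "mono_iso = (\<lambda>(M, A, m) (M', A', m') (f, g). mono_mor (M, A, m) (M', A', m') (f, g) \<and>
     (\<exists>f' g'. mono_mor (M', A', m') (M, A, m) (f', g') \<and>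
        (\<forall>x \<in> carrier M. f' (f x) = x) \<and> (\<forall>x \<in> carrier M'. f (f' x) = x) \<and>
        (\<forall>x \<in> carrier A. g' (g x) = x) \<and> (\<forall>x \<in> carrier A'. g (g' x) = x)))"

definition N_ob :: "'a eq_ob \<Rightarrow> ('a, 'a) mono_ob" where
  "N_ob = (\<lambda>(A, S). (A\<lparr>carrier := zero_cls A S\<rparr>, A, \<lambda>x. x))"

definition E_ob :: "('b, 'a) mono_ob \<Rightarrow> 'a eq_ob" where
  "E_ob = (\<lambda>(M, A, m). (A, E_rel A (m ` carrier M)))"

text \<open>
  Both \<open>E\<close> and \<open>N\<close> preserve the ambient monoid \<open>A\<close>, and transposition keeps the component on \<open>A\<close>
  (see \<open>adjunction\<close> below). So the unit at \<open>m\<close> is the square from \<open>m\<close> to the inclusion of the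
  zero-class of \<open>E(m)\<close> with components \<open>m\<close> (corestricted) and the identity of \<open>A\<close>; the counit is
  the identity of \<open>A\<close>.
\<close>

definition eta :: "('b, 'a) mono_ob \<Rightarrow> ('b \<Rightarrow> 'a) \<times> ('a \<Rightarrow> 'a)" where
  "eta = (\<lambda>(M, A, m). (m, \<lambda>x. x))"

definition eps :: "'a eq_ob \<Rightarrow> 'a \<Rightarrow> 'a" where
  "eps = (\<lambda>(A, S). (\<lambda>x. x))"

lemma monoid_mono_image:
  assumes "monoid M" "monoid_mono M A m"
  shows "m ` carrier M \<subseteq> carrier A" "\<one>\<^bsub>A\<^esub> \<in> m ` carrier M"
proof -
  have "m \<one>\<^bsub>M\<^esub> = \<one>\<^bsub>A\<^esub>" using assms(2) by (simp add: monoid_mono_def monoid_hom_def)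
  then show "\<one>\<^bsub>A\<^esub> \<in> m ` carrier M" using monoid.one_closed[OF assms(1)] by (metis imageI)
  show "m ` carrier M \<subseteq> carrier A" using assms(2) by (auto simp: monoid_mono_def monoid_hom_def hom_def)
qed

lemma adjunction:
  assumes X: "mono_obj (M, A, m)" and Y: "eq_obj (B, T)"
  shows "eq_mor (E_ob (M, A, m)) (B, T) g \<longleftrightarrow> mono_mor (M, A, m) (N_ob (B, T)) (g \<circ> m, g)"
proof -
  let ?I = "m ` carrier M"
  from X have A: "monoid A" and M: "monoid M" and m: "monoid_mono M A m" by (auto simp: mono_obj_def)
  from Y have B: "monoid B" and T: "congruence B T" by (auto simp: eq_obj_def)
  from T have eqT: "equiv (carrier B) T" and subT: "submonoid T (B \<times>\<times> B)" by (auto simp: congruence_def)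
  note I = monoid_mono_image[OF M m]
  have main: "(\<forall>(x, y) \<in> E_rel A ?I. (g x, g y) \<in> T) \<longleftrightarrow> (\<forall>x \<in> carrier M. g (m x) \<in> zero_cls B T)"
    if g: "monoid_hom A B g"
  proof
    assume l: "\<forall>(x, y) \<in> E_rel A ?I. (g x, g y) \<in> T"
    show "\<forall>x \<in> carrier M. g (m x) \<in> zero_cls B T"
    proof
      fix x assume "x \<in> carrier M"
      then have "(\<one>\<^bsub>A\<^esub>, m x) \<in> E_rel A ?I" "m x \<in> carrier A"
        using E_rel_zero_cls[OF I] by (auto simp: zero_cls_def)
      with l g show "g (m x) \<in> zero_cls B T"
        by (auto simp: zero_cls_def monoid_hom_def hom_def)
    qed
  next
    assume r: "\<forall>x \<in> carrier M. g (m x) \<in> zero_cls B T"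
    let ?S = "{(x, y) \<in> carrier A \<times> carrier A. (g x, g y) \<in> T}"
    have gc: "g x \<in> carrier B" if "x \<in> carrier A" for x
      using that g by (auto simp: monoid_hom_def hom_def)
    have gm: "g (x \<otimes>\<^bsub>A\<^esub> y) = g x \<otimes>\<^bsub>B\<^esub> g y" if "x \<in> carrier A" "y \<in> carrier A" for x y
      using that g by (auto simp: monoid_hom_def hom_def)
    have "equiv (carrier A) ?S"
    proof (rule equivI)
      show "refl_on (carrier A) ?S" using eqT gc by (auto simp: equiv_def refl_on_def)
      show "sym ?S" using eqT by (auto simp: equiv_def sym_def)
      show "trans ?S" using eqT by (auto simp: equiv_def intro!: transI dest: transD)
    qed auto
    moreover have "submonoid ?S (A \<times>\<times> A)"
    proof
      show "x \<otimes>\<^bsub>A \<times>\<times> A\<^esub> y \<in> ?S" if "x \<in> ?S" "y \<in> ?S" for x y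
        using that A submonoid.m_closed[OF subT, of "map_prod g g x" "map_prod g g y"]
        by (auto simp: gm monoid.m_closed)
      show "\<one>\<^bsub>A \<times>\<times> A\<^esub> \<in> ?S"
        using A g submonoid.one_closed[OF subT] by (auto simp: monoid_hom_def monoid.one_closed)
    qed auto
    ultimately have "congruence A ?S" by (simp add: congruence_def)
    moreover have "?I \<subseteq> zero_cls A ?S"
      using r I A g by (auto simp: zero_cls_def monoid_hom_def monoid.one_closed)
    ultimately have "E_rel A ?I \<subseteq> ?S" by (rule E_rel_least)
    then show "\<forall>(x, y) \<in> E_rel A ?I. (g x, g y) \<in> T" by auto
  qed
  have comp: "monoid_hom M (B\<lparr>carrier := zero_cls B T\<rparr>) (g \<circ> m) \<longleftrightarrow>
      (\<forall>x \<in> carrier M. g (m x) \<in> zero_cls B T)" if "monoid_hom A B g"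
    using that m by (auto simp: monoid_mono_def monoid_hom_def hom_def Pi_def)
  show ?thesis
    using main comp by (auto simp: eq_mor_def E_ob_def N_ob_def mono_mor_def)
qed

definition Fix_eta :: "('b, 'a) mono_ob set" where
  "Fix_eta = {X. mono_obj X \<and> mono_iso X (N_ob (E_ob X)) (eta X)}"

definition Fix_eps :: "'a eq_ob set" where
  "Fix_eps = {Y. eq_obj Y \<and> eq_iso (E_ob (N_ob Y)) Y (eps Y)}"

text \<open>
  \<open>E(m)\<close> always lies in \<open>Fix_eps\<close> (triangle identities): with \<open>N = [1]\<^bsub>E(m)\<^esub>\<close> and \<open>M \<subseteq> N\<close>, the
  smallest congruences whose zero-classes contain \<open>M\<close> and \<open>N\<close> coincide. So membership of \<open>E(m)\<close> in
  \<open>Fix_eps\<close> is a condition on \<open>m\<close> only together with \<open>m\<close> being the zero-class that generates \<open>E(m)\<close>.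
\<close>

lemma E_ob_in_Fix_eps:
  assumes X: "mono_obj (M, A, m)"
  shows "E_ob (M, A, m) \<in> Fix_eps"
proof -
  let ?I = "m ` carrier M"
  let ?Z = "zero_cls A (E_rel A ?I)"
  from X have A: "monoid A" and M: "monoid M" and m: "monoid_mono M A m" by (auto simp: mono_obj_def)
  note I = monoid_mono_image[OF M m]
  have cI: "congruence A (E_rel A ?I)" by (rule E_rel_congruence[OF A I(1)])
  have Z: "?Z \<subseteq> carrier A" "?I \<subseteq> ?Z" using E_rel_zero_cls[OF I] by (auto simp: zero_cls_def)
  have "E_rel A ?Z \<subseteq> E_rel A ?I" by (rule E_rel_least[OF cI]) simp
  moreover have "E_rel A ?I \<subseteq> E_rel A ?Z"
    using Z I E_rel_zero_cls[of ?Z A] by (intro E_rel_least E_rel_congruence A) auto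
  ultimately have eq: "E_rel A ?Z = E_rel A ?I" by (rule subset_antisym)
  have "eq_mor (A, E_rel A ?I) (A, E_rel A ?I) (\<lambda>x. x)"
    by (auto simp: eq_mor_def monoid_hom_def hom_def)
  then show ?thesis
    using A cI eq by (auto simp: Fix_eps_def eq_obj_def eq_iso_def E_ob_def N_ob_def eps_def)
qed

section \<open>Normal monomorphisms\<close>

text \<open>
  The square \<open>f \<circ> p = g \<circ> q\<close> is a pullback of monoids, with test monoids carried by the type \<open>'t\<close>.
\<close>

definition is_pullback :: "'t itself \<Rightarrow> 'p monoid \<Rightarrow> 'x monoid \<Rightarrow> 'y monoid \<Rightarrow> 'z monoid \<Rightarrow>
    ('p \<Rightarrow> 'x) \<Rightarrow> ('p \<Rightarrow> 'y) \<Rightarrow> ('x \<Rightarrow> 'z) \<Rightarrow> ('y \<Rightarrow> 'z) \<Rightarrow> bool" where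
  "is_pullback _ P X Y Z p q f g \<longleftrightarrow>
     monoid_hom P X p \<and> monoid_hom P Y q \<and> monoid_hom X Z f \<and> monoid_hom Y Z g \<and>
     (\<forall>z \<in> carrier P. f (p z) = g (q z)) \<and>
     (\<forall>(Q :: 't monoid) a b. monoid Q \<and> monoid_hom Q X a \<and> monoid_hom Q Y b \<and>
        (\<forall>z \<in> carrier Q. f (a z) = g (b z)) \<longrightarrow>
        (\<exists>h. monoid_hom Q P h \<and> (\<forall>z \<in> carrier Q. p (h z) = a z \<and> q (h z) = b z) \<and>
          (\<forall>k. monoid_hom Q P k \<and> (\<forall>z \<in> carrier Q. p (k z) = a z \<and> q (k z) = b z) \<longrightarrow>
            (\<forall>z \<in> carrier Q. k z = h z))))"

text \<open>
  \<open>m\<close> is the pullback of the inclusion of some congruence \<open>S\<close> into \<open>A \<times> A\<close> along \<open>a \<mapsto> (1, a)\<close>.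
  Test monoids on the carrier type of \<open>A\<close> suffice: by \<open>is_pullback_any_type\<close> below, the universal
  property then holds for test monoids of every type.
\<close>

definition normal_mono :: "'b monoid \<Rightarrow> 'a monoid \<Rightarrow> ('b \<Rightarrow> 'a) \<Rightarrow> bool" where
  "normal_mono M A m \<longleftrightarrow> (\<exists>S. congruence A S \<and>
     (\<exists>q. is_pullback TYPE('a) M A ((A \<times>\<times> A)\<lparr>carrier := S\<rparr>) (A \<times>\<times> A) m q
            (\<lambda>a. (\<one>\<^bsub>A\<^esub>, a)) (\<lambda>s. s)))"

lemma is_pullback_any_type:
  assumes pb: "is_pullback TYPE('a) M (A :: 'a monoid) ((A \<times>\<times> A)\<lparr>carrier := S\<rparr>) (A \<times>\<times> A) m q
      (\<lambda>a. (\<one>\<^bsub>A\<^esub>, a)) (\<lambda>s. s)"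
    and A: "monoid A" and m: "monoid_mono M A m"
  shows "is_pullback TYPE('c) M A ((A \<times>\<times> A)\<lparr>carrier := S\<rparr>) (A \<times>\<times> A) m q
      (\<lambda>a. (\<one>\<^bsub>A\<^esub>, a)) (\<lambda>s. s)"
  unfolding is_pullback_def
proof (intro conjI allI impI; (elim conjE)?)
  fix Q :: "'c monoid" and a b
  assume Q: "monoid Q" and a: "monoid_hom Q A a"
    and b: "monoid_hom Q ((A \<times>\<times> A)\<lparr>carrier := S\<rparr>) b"
    and ab: "\<forall>z \<in> carrier Q. (\<one>\<^bsub>A\<^esub>, a z) = b z"
  interpret A: monoid A by (rule A)
  interpret Q: monoid Q by (rule Q)
  let ?Q = "A\<lparr>carrier := a ` carrier Q\<rparr>"
  have a1: "a \<one>\<^bsub>Q\<^esub> = \<one>\<^bsub>A\<^esub>" and ac: "\<And>x. x \<in> carrier Q \<Longrightarrow> a x \<in> carrier A"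
    and am: "\<And>x y. x \<in> carrier Q \<Longrightarrow> y \<in> carrier Q \<Longrightarrow> a (x \<otimes>\<^bsub>Q\<^esub> y) = a x \<otimes>\<^bsub>A\<^esub> a y"
    using a by (auto simp: monoid_hom_def hom_def)
  have "submonoid (a ` carrier Q) A"
  proof
    show "x \<otimes>\<^bsub>A\<^esub> y \<in> a ` carrier Q" if "x \<in> a ` carrier Q" "y \<in> a ` carrier Q" for x y
      using that by (metis (no_types, lifting) Q.m_closed am imageE imageI)
    show "\<one>\<^bsub>A\<^esub> \<in> a ` carrier Q" using a1 by (metis Q.one_closed imageI)
  qed (use ac in auto)
  then have mon: "monoid ?Q" using A by (rule submonoid.submonoid_is_monoid)
  moreover have "monoid_hom ?Q A (\<lambda>x. x)"
    using ac by (auto simp: monoid_hom_def hom_def)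
  moreover have "monoid_hom ?Q ((A \<times>\<times> A)\<lparr>carrier := S\<rparr>) (\<lambda>x. (\<one>\<^bsub>A\<^esub>, x))"
  proof -
    have bz: "b z = (\<one>\<^bsub>A\<^esub>, a z)" if "z \<in> carrier Q" for z using ab that by simp
    have "(\<one>\<^bsub>A\<^esub>, a z) \<in> S" if "z \<in> carrier Q" for z
      using b bz[OF that] that by (auto simp: monoid_hom_def hom_def Pi_def)
    then show ?thesis by (auto simp: monoid_hom_def hom_def)
  qed
  ultimately have "\<exists>h. monoid_hom ?Q M h \<and> (\<forall>z \<in> carrier ?Q. m (h z) = z \<and> q (h z) = (\<one>\<^bsub>A\<^esub>, z))"
    using pb unfolding is_pullback_def by blast
  then obtain h where h: "monoid_hom ?Q M h"
      "\<And>z. z \<in> a ` carrier Q \<Longrightarrow> m (h z) = z \<and> q (h z) = (\<one>\<^bsub>A\<^esub>, z)"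
    by auto
  have ha: "monoid_hom Q M (h \<circ> a)"
    using h(1) a1 by (auto simp: monoid_hom_def hom_def am)
  have hm: "m ((h \<circ> a) z) = a z \<and> q ((h \<circ> a) z) = b z" if "z \<in> carrier Q" for z
    using h(2)[of "a z"] ab that by auto
  have "k z = (h \<circ> a) z" if "monoid_hom Q M k" "\<forall>z \<in> carrier Q. m (k z) = a z \<and> q (k z) = b z"
    "z \<in> carrier Q" for k z
  proof (rule inj_onD[where f = m and A = "carrier M"])
    show "inj_on m (carrier M)" using m by (simp add: monoid_mono_def)
    show "m (k z) = m ((h \<circ> a) z)" using that hm by auto
    show "k z \<in> carrier M" "(h \<circ> a) z \<in> carrier M"
      using that ha by (auto simp: monoid_hom_def hom_def)
  qed
  with ha hm show "\<exists>h. monoid_hom Q M h \<and> (\<forall>z \<in> carrier Q. m (h z) = a z \<and> q (h z) = b z) \<and>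
      (\<forall>k. monoid_hom Q M k \<and> (\<forall>z \<in> carrier Q. m (k z) = a z \<and> q (k z) = b z) \<longrightarrow>
        (\<forall>z \<in> carrier Q. k z = h z))"
    by blast
qed (use pb in \<open>simp_all add: is_pullback_def\<close>)

section \<open>Sums of a row\<close>

text \<open>
  \<open>row_sum A n a w i\<close> is \<open>a\<^sub>i\<^sub>1 + w\<^sub>i\<^sub>1 + \<dots> + a\<^sub>i\<^sub>n + w\<^sub>i\<^sub>n\<close>, the (not necessarily commutative)
  operation of \<open>A\<close> being written additively.
\<close>

definition row_sum ::
  "'a monoid \<Rightarrow> nat \<Rightarrow> (nat \<Rightarrow> nat \<Rightarrow> 'a) \<Rightarrow> (nat \<Rightarrow> nat \<Rightarrow> 'a) \<Rightarrow> nat \<Rightarrow> 'a" where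
  "row_sum A n a w i = foldr (\<otimes>\<^bsub>A\<^esub>) (map (\<lambda>j. a i j \<otimes>\<^bsub>A\<^esub> w i j) [1..<Suc n]) \<one>\<^bsub>A\<^esub>"

end

theory Submission
  imports Defs
begin

text \<open>
  The conditions are linked through the existence of a congruence with zero-class \<open>I\<close>.
  For such a congruence, \<open>1 \<sim> u\<close> gives \<open>xy \<sim> xuy\<close>, which is (g), and (g) says precisely that
  \<open>I\<close> lies in the zero-class of its syntactic congruence (the other inclusion holds because
  \<open>1 \<in> I\<close>). For (h), the submonoid generated by \<open>I \<times> I\<close> and the diagonal consists of the pairs
  \<open>(a\<^sub>1v\<^sub>1\<cdots>a\<^sub>nv\<^sub>n, a\<^sub>1u\<^sub>1\<cdots>a\<^sub>nu\<^sub>n)\<close>. Since \<open>E_rel\<close> is the transitive closure of this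
  submonoid, a chain witnessing \<open>1 \<sim> x\<close> is a system of equations as in (h), once all rows are
  padded with units to the same length.
\<close>

section \<open>Congruences and their zero-classes\<close>

lemma congruence_mult:
  assumes "congruence A S" "(a, b) \<in> S" "(c, d) \<in> S"
  shows "(a \<otimes>\<^bsub>A\<^esub> c, b \<otimes>\<^bsub>A\<^esub> d) \<in> S"
  using assms submonoid.m_closed[of S "A \<times>\<times> A" "(a, b)" "(c, d)"] by (simp add: congruence_def)

lemma congruence_refl: "congruence A S \<Longrightarrow> x \<in> carrier A \<Longrightarrow> (x, x) \<in> S"
  by (auto simp: congruence_def equiv_def refl_on_def)

lemma congruence_sym: "congruence A S \<Longrightarrow> (x, y) \<in> S \<Longrightarrow> (y, x) \<in> S"
  by (auto simp: congruence_def equiv_def dest: symD)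

lemma congruence_trans: "congruence A S \<Longrightarrow> (x, y) \<in> S \<Longrightarrow> (y, z) \<in> S \<Longrightarrow> (x, z) \<in> S"
  by (auto simp: congruence_def equiv_def dest: transD)

lemma congruence_carrier:
  assumes "congruence A S" "(x, y) \<in> S"
  shows "x \<in> carrier A" "y \<in> carrier A"
  using assms by (auto simp: congruence_def equiv_def)

text \<open>Makes the zero-class a monoid, so that it can be a test object for the pullback in
  \<open>normal_mono_iff_zero_cls\<close>.\<close>

lemma zero_cls_submonoid:
  assumes A: "monoid A" and S: "congruence A S"
  shows "submonoid (zero_cls A S) A"
proof
  interpret monoid A by (rule A)
  show "zero_cls A S \<subseteq> carrier A" by (auto simp: zero_cls_def)
  show "x \<otimes>\<^bsub>A\<^esub> y \<in> zero_cls A S" if "x \<in> zero_cls A S" "y \<in> zero_cls A S" for x y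
    using that congruence_mult[OF S, of "\<one>\<^bsub>A\<^esub>" x "\<one>\<^bsub>A\<^esub>" y] by (simp add: zero_cls_def)
  show "\<one>\<^bsub>A\<^esub> \<in> zero_cls A S" using congruence_refl[OF S] by (simp add: zero_cls_def)
qed

text \<open>Multiplying \<open>(1, u)\<close> on both sides by diagonal pairs relates
  \<open>xy\<close> to \<open>xuy\<close>, and congruent elements are both related to
  \<open>1\<close> or both not.\<close>

lemma zero_cls_cancel:
  assumes A: "monoid A" and S: "congruence A S"
    and x: "x \<in> carrier A" and y: "y \<in> carrier A" and u: "u \<in> zero_cls A S"
  shows "x \<otimes>\<^bsub>A\<^esub> y \<in> zero_cls A S \<longleftrightarrow> x \<otimes>\<^bsub>A\<^esub> u \<otimes>\<^bsub>A\<^esub> y \<in> zero_cls A S"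
proof -
  interpret monoid A by (rule A)
  have uc: "u \<in> carrier A" and "(\<one>\<^bsub>A\<^esub>, u) \<in> S" using u by (auto simp: zero_cls_def)
  then have "(x \<otimes>\<^bsub>A\<^esub> \<one>\<^bsub>A\<^esub> \<otimes>\<^bsub>A\<^esub> y, x \<otimes>\<^bsub>A\<^esub> u \<otimes>\<^bsub>A\<^esub> y) \<in> S"
    using x y by (intro congruence_mult[OF S] congruence_refl[OF S])
  then have "(x \<otimes>\<^bsub>A\<^esub> y, x \<otimes>\<^bsub>A\<^esub> u \<otimes>\<^bsub>A\<^esub> y) \<in> S" using x by simp
  then show ?thesis
    using x y uc congruence_trans[OF S] congruence_sym[OF S] unfolding zero_cls_def by blast
qed

section \<open>The syntactic congruence\<close>

lemma syntactic_congruence_congruence: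
  assumes A: "monoid A"
  shows "congruence A (syntactic_congruence A M)"
proof -
  interpret monoid A by (rule A)
  let ?S = "syntactic_congruence A M"
  have "equiv (carrier A) ?S"
    by (rule equivI) (auto simp: syntactic_congruence_def refl_on_def sym_def trans_def)
  moreover have "submonoid ?S (A \<times>\<times> A)"
  proof
    show "?S \<subseteq> carrier (A \<times>\<times> A)" by (auto simp: syntactic_congruence_def)
    show "\<one>\<^bsub>A \<times>\<times> A\<^esub> \<in> ?S" by (simp add: syntactic_congruence_def)
    fix p q assume "p \<in> ?S" "q \<in> ?S"
    then obtain a b c d where pq: "p = (a, b)" "q = (c, d)"
      and ab: "(a, b) \<in> ?S" and cd: "(c, d) \<in> ?S" by (cases p; cases q) auto
    then have cl: "a \<in> carrier A" "b \<in> carrier A" "c \<in> carrier A" "d \<in> carrier A"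
      by (auto simp: syntactic_congruence_def)
    have "x \<otimes>\<^bsub>A\<^esub> (a \<otimes>\<^bsub>A\<^esub> c) \<otimes>\<^bsub>A\<^esub> y \<in> M \<longleftrightarrow> x \<otimes>\<^bsub>A\<^esub> (b \<otimes>\<^bsub>A\<^esub> d) \<otimes>\<^bsub>A\<^esub> y \<in> M"
      if xy: "x \<in> carrier A" "y \<in> carrier A" for x y
    proof -
      \<comment> \<open>One factor is exchanged at a time: first \<open>a\<close> for
        \<open>b\<close> with \<open>c\<close> absorbed into the right context, then
        \<open>c\<close> for \<open>d\<close> with \<open>b\<close> absorbed into the left
        context.\<close>
      have "x \<otimes>\<^bsub>A\<^esub> a \<otimes>\<^bsub>A\<^esub> (c \<otimes>\<^bsub>A\<^esub> y) \<in> M \<longleftrightarrow> x \<otimes>\<^bsub>A\<^esub> b \<otimes>\<^bsub>A\<^esub> (c \<otimes>\<^bsub>A\<^esub> y) \<in> M"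
        using ab xy cl by (simp add: syntactic_congruence_def)
      moreover have "(x \<otimes>\<^bsub>A\<^esub> b) \<otimes>\<^bsub>A\<^esub> c \<otimes>\<^bsub>A\<^esub> y \<in> M \<longleftrightarrow> (x \<otimes>\<^bsub>A\<^esub> b) \<otimes>\<^bsub>A\<^esub> d \<otimes>\<^bsub>A\<^esub> y \<in> M"
        using cd xy cl by (simp add: syntactic_congruence_def del: m_assoc)
      ultimately show ?thesis using xy cl by (simp add: m_assoc)
    qed
    then show "p \<otimes>\<^bsub>A \<times>\<times> A\<^esub> q \<in> ?S" using pq cl by (simp add: syntactic_congruence_def)
  qed
  ultimately show ?thesis by (simp add: congruence_def)
qed

lemma zero_cls_syntactic_congruence:
  assumes A: "monoid A" and I: "I \<subseteq> carrier A" "\<one>\<^bsub>A\<^esub> \<in> I"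
  shows "I = zero_cls A (syntactic_congruence A I) \<longleftrightarrow>
    (\<forall>x \<in> carrier A. \<forall>y \<in> carrier A. \<forall>u \<in> I.
      x \<otimes>\<^bsub>A\<^esub> y \<in> I \<longleftrightarrow> x \<otimes>\<^bsub>A\<^esub> u \<otimes>\<^bsub>A\<^esub> y \<in> I)"
proof -
  interpret monoid A by (rule A)
  have "zero_cls A (syntactic_congruence A I) \<subseteq> I"
  proof
    fix u assume "u \<in> zero_cls A (syntactic_congruence A I)"
    \<comment> \<open>The trivial context \<open>x = y = 1\<close> suffices: it transfers membership
      in \<open>I\<close> from \<open>1\<close> to \<open>u\<close>.\<close>
    then have "u \<in> carrier A" and
      "\<one>\<^bsub>A\<^esub> \<otimes>\<^bsub>A\<^esub> \<one>\<^bsub>A\<^esub> \<otimes>\<^bsub>A\<^esub> \<one>\<^bsub>A\<^esub> \<in> I \<longleftrightarrow> \<one>\<^bsub>A\<^esub> \<otimes>\<^bsub>A\<^esub> u \<otimes>\<^bsub>A\<^esub> \<one>\<^bsub>A\<^esub> \<in> I"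
      using one_closed unfolding zero_cls_def syntactic_congruence_def by blast+
    then show "u \<in> I" using I by simp
  qed
  moreover have "I \<subseteq> zero_cls A (syntactic_congruence A I) \<longleftrightarrow>
    (\<forall>x \<in> carrier A. \<forall>y \<in> carrier A. \<forall>u \<in> I.
      x \<otimes>\<^bsub>A\<^esub> y \<in> I \<longleftrightarrow> x \<otimes>\<^bsub>A\<^esub> u \<otimes>\<^bsub>A\<^esub> y \<in> I)"
    using I(1) by (auto simp: zero_cls_def syntactic_congruence_def subset_iff)
  ultimately show ?thesis by blast
qed

text \<open>Zero-classes are monotone in the congruence. If \<open>S\<close> has zero-class
  \<open>I\<close>, then \<open>E_rel A I\<close> lies below \<open>S\<close>, so its zero-class is
  squeezed between \<open>I\<close> and \<open>I\<close>.\<close>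

lemma zero_cls_E_rel:
  assumes A: "monoid A" and I: "I \<subseteq> carrier A" "\<one>\<^bsub>A\<^esub> \<in> I"
  shows "I = zero_cls A (E_rel A I) \<longleftrightarrow> (\<exists>S. congruence A S \<and> I = zero_cls A S)"
proof
  assume "\<exists>S. congruence A S \<and> I = zero_cls A S"
  then obtain S where S: "congruence A S" "I = zero_cls A S" by blast
  have "E_rel A I \<subseteq> S" using S by (intro E_rel_least) auto
  then have "zero_cls A (E_rel A I) \<subseteq> I" using S(2) by (auto simp: zero_cls_def)
  then show "I = zero_cls A (E_rel A I)" using E_rel_zero_cls[OF I] by blast
qed (use E_rel_congruence[OF A I(1)] in blast)

text \<open>Identifies (d) with (c). \<open>LEAST\<close> refers to inclusion of relations, and here
  the minimum exists.\<close>

lemma Least_congruence: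
  assumes "monoid A" "I \<subseteq> carrier A" "\<one>\<^bsub>A\<^esub> \<in> I"
  shows "(LEAST S. congruence A S \<and> I \<subseteq> zero_cls A S) = E_rel A I"
  by (rule Least_equality)
    (use assms in \<open>auto simp: E_rel_congruence E_rel_zero_cls[THEN subsetD] dest: E_rel_least[THEN subsetD]\<close>)

section \<open>Corestriction of monomorphisms\<close>

text \<open>Corestriction along \<open>m\<close>: since \<open>m\<close> is injective and
  multiplicative, its inverse on the image is multiplicative too. This yields the mediating
  morphisms of the pullback and the inverse of the unit.\<close>

lemma monoid_hom_inv_into:
  assumes M: "monoid M" and m: "monoid_mono M A m" and a: "monoid_hom Q A a"
    and im: "a ` carrier Q \<subseteq> m ` carrier M"
  shows "monoid_hom Q M (inv_into (carrier M) m \<circ> a)"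
proof -
  let ?g = "inv_into (carrier M) m"
  have inj: "inj_on m (carrier M)" and m1: "m \<one>\<^bsub>M\<^esub> = \<one>\<^bsub>A\<^esub>"
    and mm: "\<And>x y. x \<in> carrier M \<Longrightarrow> y \<in> carrier M \<Longrightarrow> m (x \<otimes>\<^bsub>M\<^esub> y) = m x \<otimes>\<^bsub>A\<^esub> m y"
    using m by (auto simp: monoid_mono_def monoid_hom_def hom_def)
  have g: "?g (a x) \<in> carrier M" "m (?g (a x)) = a x" if "x \<in> carrier Q" for x
    using im imageI[OF that, of a] by (blast intro: inv_into_into f_inv_into_f)+
  have "?g (a (x \<otimes>\<^bsub>Q\<^esub> y)) = ?g (a x) \<otimes>\<^bsub>M\<^esub> ?g (a y)" if xy: "x \<in> carrier Q" "y \<in> carrier Q" for x y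
  proof -
    have "a (x \<otimes>\<^bsub>Q\<^esub> y) = m (?g (a x) \<otimes>\<^bsub>M\<^esub> ?g (a y))"
      using a xy g mm by (auto simp: monoid_hom_def hom_def)
    then show ?thesis using inj g xy M by (simp add: monoid.m_closed)
  qed
  moreover have "?g (a \<one>\<^bsub>Q\<^esub>) = \<one>\<^bsub>M\<^esub>"
    using a inj m1 M by (metis inv_into_f_f monoid.one_closed monoid_hom_def)
  ultimately show ?thesis using g by (auto simp: monoid_hom_def hom_def)
qed

text \<open>The pullback of a congruence \<open>S\<close> along \<open>a \<mapsto> (1, a)\<close>
  consists of the \<open>a\<close> with \<open>(1, a) \<in> S\<close>, which is the zero-class. A
  pullback is determined up to isomorphism over \<open>A\<close>, so only the image of
  \<open>m\<close> matters.\<close>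

lemma normal_mono_iff_zero_cls:
  assumes A: "monoid A" and M: "monoid M" and m: "monoid_mono M A m"
  shows "normal_mono M A m \<longleftrightarrow> (\<exists>S. congruence A S \<and> m ` carrier M = zero_cls A S)"
proof
  interpret A: monoid A by (rule A)
  assume "normal_mono M A m"
  then obtain S q where S: "congruence A S" and
    pb: "is_pullback TYPE('a) M A ((A \<times>\<times> A)\<lparr>carrier := S\<rparr>) (A \<times>\<times> A) m q
            (\<lambda>a. (\<one>\<^bsub>A\<^esub>, a)) (\<lambda>s. s)"
    unfolding normal_mono_def by blast
  have "m ` carrier M \<subseteq> zero_cls A S"
    using pb by (auto simp: is_pullback_def zero_cls_def monoid_hom_def hom_def Pi_def)
  moreover have "zero_cls A S \<subseteq> m ` carrier M"
  proof -
    \<comment> \<open>The zero-class, with its inclusion into \<open>A\<close> and with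
      \<open>x \<mapsto> (1, x)\<close> into \<open>S\<close>, is a cone. Its factorization
      \<open>h\<close> provides preimages under \<open>m\<close>.\<close>
    let ?Q = "A\<lparr>carrier := zero_cls A S\<rparr>"
    have "monoid ?Q" using zero_cls_submonoid[OF A S] A by (rule submonoid.submonoid_is_monoid)
    moreover have "monoid_hom ?Q A (\<lambda>x. x)"
      by (auto simp: monoid_hom_def hom_def zero_cls_def)
    moreover have "monoid_hom ?Q ((A \<times>\<times> A)\<lparr>carrier := S\<rparr>) (\<lambda>x. (\<one>\<^bsub>A\<^esub>, x))"
      by (auto simp: monoid_hom_def hom_def zero_cls_def)
    ultimately have "\<exists>h. monoid_hom ?Q M h \<and> (\<forall>z \<in> carrier ?Q. m (h z) = z \<and> q (h z) = (\<one>\<^bsub>A\<^esub>, z))"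
      using pb unfolding is_pullback_def by blast
    then obtain h where h: "monoid_hom ?Q M h" "\<forall>z \<in> zero_cls A S. m (h z) = z" by auto
    have "z \<in> m ` carrier M" if "z \<in> zero_cls A S" for z
      using h that by (intro image_eqI[of _ _ "h z"]) (auto simp: monoid_hom_def hom_def)
    then show ?thesis by blast
  qed
  ultimately show "\<exists>S. congruence A S \<and> m ` carrier M = zero_cls A S" using S by blast
next
  interpret A: monoid A by (rule A)
  assume "\<exists>S. congruence A S \<and> m ` carrier M = zero_cls A S"
  then obtain S where S: "congruence A S" and I: "m ` carrier M = zero_cls A S" by blast
  \<comment> \<open>Commutativity of the square forces this choice of the projection to
    \<open>S\<close>.\<close>
  let ?q = "\<lambda>z. (\<one>\<^bsub>A\<^esub>, m z)" and ?g = "inv_into (carrier M) m"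
  have mS: "(\<one>\<^bsub>A\<^esub>, m x) \<in> S" if "x \<in> carrier M" for x
    using that I by (auto simp: zero_cls_def)
  have mh: "monoid_hom M A m" and inj: "inj_on m (carrier M)" using m by (auto simp: monoid_mono_def)
  have "is_pullback TYPE('a) M A ((A \<times>\<times> A)\<lparr>carrier := S\<rparr>) (A \<times>\<times> A) m ?q
            (\<lambda>a. (\<one>\<^bsub>A\<^esub>, a)) (\<lambda>s. s)"
    unfolding is_pullback_def
  proof (intro conjI allI impI; (elim conjE)?)
    show "monoid_hom M ((A \<times>\<times> A)\<lparr>carrier := S\<rparr>) ?q"
      using mh mS by (auto simp: monoid_hom_def hom_def)
    show "monoid_hom A (A \<times>\<times> A) (\<lambda>a. (\<one>\<^bsub>A\<^esub>, a))" by (auto simp: monoid_hom_def hom_def)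
    show "monoid_hom ((A \<times>\<times> A)\<lparr>carrier := S\<rparr>) (A \<times>\<times> A) (\<lambda>s. s)"
      using congruence_carrier[OF S] by (auto simp: monoid_hom_def hom_def)
    fix Q :: "'a monoid" and a b
    assume a: "monoid_hom Q A a" and b: "monoid_hom Q ((A \<times>\<times> A)\<lparr>carrier := S\<rparr>) b"
      and ab: "\<forall>z \<in> carrier Q. (\<one>\<^bsub>A\<^esub>, a z) = b z"
    have "b z \<in> S" if "z \<in> carrier Q" for z
      using b that by (auto simp: monoid_hom_def hom_def)
    then have "a ` carrier Q \<subseteq> zero_cls A S"
      using a ab by (auto simp: zero_cls_def monoid_hom_def hom_def)
    then have im: "a ` carrier Q \<subseteq> m ` carrier M" using I by simp
    have mg: "m (?g (a z)) = a z" if "z \<in> carrier Q" for z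
      using im imageI[OF that, of a] by (blast intro: f_inv_into_f)
    show "\<exists>h. monoid_hom Q M h \<and> (\<forall>z \<in> carrier Q. m (h z) = a z \<and> ?q (h z) = b z) \<and>
      (\<forall>k. monoid_hom Q M k \<and> (\<forall>z \<in> carrier Q. m (k z) = a z \<and> ?q (k z) = b z) \<longrightarrow>
        (\<forall>z \<in> carrier Q. k z = h z))"
    proof (intro exI[of _ "?g \<circ> a"] conjI allI impI ballI; (elim conjE)?)
      show "monoid_hom Q M (?g \<circ> a)" by (rule monoid_hom_inv_into[OF M m a im])
      fix k z assume "monoid_hom Q M k" "\<forall>z \<in> carrier Q. m (k z) = a z \<and> ?q (k z) = b z"
        and z: "z \<in> carrier Q"
      then have "k z \<in> carrier M" "a z = m (k z)" by (auto simp: monoid_hom_def hom_def)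
      then show "k z = (?g \<circ> a) z" using inj by simp
    qed (use mg ab in auto)
  qed (use mh in auto)
  then show "normal_mono M A m" using S unfolding normal_mono_def by blast
qed

text \<open>The unit is the identity on \<open>A\<close> and the corestriction of \<open>m\<close>
  to the zero-class of \<open>E(m)\<close>. As \<open>m\<close> is injective, it is an isomorphism
  exactly when this corestriction is onto.\<close>

lemma Fix_eta_iff_zero_cls:
  assumes A: "monoid A" and M: "monoid M" and m: "monoid_mono M A m"
  defines "I \<equiv> m ` carrier M"
  shows "(M, A, m) \<in> Fix_eta \<longleftrightarrow> I = zero_cls A (E_rel A I)"
proof -
  let ?Z = "zero_cls A (E_rel A I)"
  have sub: "I \<subseteq> ?Z" unfolding I_def by (intro E_rel_zero_cls monoid_mono_image[OF M m])
  show ?thesis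
  proof
    assume "(M, A, m) \<in> Fix_eta"
    \<comment> \<open>\<open>f\<close> is the component on the zero-class of the inverse of the
      unit; being a section of \<open>m\<close>, it makes \<open>m\<close> onto.\<close>
    then obtain f where "monoid_hom (A\<lparr>carrier := ?Z\<rparr>) M f" "\<forall>x \<in> ?Z. m (f x) = x"
      by (auto simp: Fix_eta_def mono_iso_def mono_mor_def N_ob_def E_ob_def eta_def I_def)
    then have "f x \<in> carrier M" "m (f x) = x" if "x \<in> ?Z" for x
      using that by (auto simp: monoid_hom_def hom_def Pi_def)
    then have "?Z \<subseteq> I" unfolding I_def by (metis imageI subsetI)
    with sub show "I = ?Z" by blast
  next
    assume eq: "I = ?Z"
    let ?g = "inv_into (carrier M) m"
    have mh: "monoid_hom M A m" and inj: "inj_on m (carrier M)" using m by (auto simp: monoid_mono_def)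
    have "monoid_hom (A\<lparr>carrier := I\<rparr>) A (\<lambda>x. x)"
      using monoid_mono_image[OF M m] by (auto simp: monoid_hom_def hom_def I_def)
    \<comment> \<open>The inverse is the corestriction along \<open>m\<close> of the inclusion of
      \<open>I\<close> into \<open>A\<close>.\<close>
    then have "monoid_hom (A\<lparr>carrier := I\<rparr>) M (?g \<circ> (\<lambda>x. x))"
      by (rule monoid_hom_inv_into[OF M m]) (simp add: I_def)
    moreover have mg: "m (?g x) = x" if "x \<in> I" for x
      using that unfolding I_def by (rule f_inv_into_f)
    moreover have "monoid_hom M (A\<lparr>carrier := I\<rparr>) m"
      using mh by (auto simp: monoid_hom_def hom_def I_def)
    moreover have "monoid_hom A A (\<lambda>x. x)" by (auto simp: monoid_hom_def hom_def)
    ultimately have "mono_iso (M, A, m) (A\<lparr>carrier := I\<rparr>, A, \<lambda>x. x) (m, \<lambda>x. x)"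
      using inj unfolding mono_iso_def mono_mor_def
      by (auto intro!: exI[of _ ?g] exI[of _ "\<lambda>x. x"] simp: comp_def)
    then show "(M, A, m) \<in> Fix_eta"
      using A M m eq
      by (simp add: Fix_eta_def mono_obj_def N_ob_def E_ob_def eta_def flip: I_def)
  qed
qed

section \<open>Systems of equations\<close>

text \<open>The fold behind \<open>row_sum\<close>, on arbitrary lists, so that joining rows becomes
  concatenation.\<close>

definition list_prod :: "'a monoid \<Rightarrow> 'a list \<Rightarrow> 'a" where
  "list_prod A xs = foldr (\<otimes>\<^bsub>A\<^esub>) xs \<one>\<^bsub>A\<^esub>"

lemma list_prod_simps [simp]:
  "list_prod A [] = \<one>\<^bsub>A\<^esub>" "list_prod A (x # xs) = x \<otimes>\<^bsub>A\<^esub> list_prod A xs"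
  by (simp_all add: list_prod_def)

lemma list_prod_closed:
  assumes "monoid A" "set xs \<subseteq> carrier A"
  shows "list_prod A xs \<in> carrier A"
  using assms(2) by (induction xs) (simp_all add: assms(1) monoid.m_closed monoid.one_closed)

lemma list_prod_append:
  assumes "monoid A" "set xs \<subseteq> carrier A" "set ys \<subseteq> carrier A"
  shows "list_prod A (xs @ ys) = list_prod A xs \<otimes>\<^bsub>A\<^esub> list_prod A ys"
proof -
  interpret monoid A by (rule assms(1))
  show ?thesis using assms(2,3) by (induction xs) (simp_all add: m_assoc list_prod_closed assms(1))
qed

lemma row_sum_list_prod:
  "row_sum A n a w i = list_prod A (map (\<lambda>j. a i j \<otimes>\<^bsub>A\<^esub> w i j) [1..<Suc n])"
  by (simp add: row_sum_def list_prod_def)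

lemma row_sum_congruent:
  assumes S: "congruence A S"
    and "\<And>j. j \<in> {1..n} \<Longrightarrow> a i j \<in> carrier A" "\<And>j. j \<in> {1..n} \<Longrightarrow> (v i j, u i j) \<in> S"
  shows "(row_sum A n a v i, row_sum A n a u i) \<in> S"
proof -
  have "(\<one>\<^bsub>A\<^esub>, \<one>\<^bsub>A\<^esub>) \<in> S"
    using S submonoid.one_closed[of S "A \<times>\<times> A"] by (simp add: congruence_def)
  \<comment> \<open>The index range is generalised to an arbitrary list \<open>js\<close> to make
    induction possible.\<close>
  then have "(list_prod A (map (\<lambda>j. a i j \<otimes>\<^bsub>A\<^esub> v i j) js), list_prod A (map (\<lambda>j. a i j \<otimes>\<^bsub>A\<^esub> u i j) js)) \<in> S"
    if "set js \<subseteq> {1..n}" for js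
    using that by (induction js) (auto intro!: congruence_mult[OF S] congruence_refl[OF S] assms(2,3))
  then show ?thesis unfolding row_sum_list_prod by (simp del: upt_Suc add: atLeastLessThanSuc_atLeastAtMost)
qed

text \<open>A triple \<open>(a, v, u)\<close> holds the entries of one row of (h) at one column. The
  length \<open>n\<close> is a parameter because all rows of (h) share it.\<close>

definition row_rel :: "'a monoid \<Rightarrow> 'a set \<Rightarrow> nat \<Rightarrow> 'a rel" where
  "row_rel A I n = {(list_prod A (map (\<lambda>(a, v, u). a \<otimes>\<^bsub>A\<^esub> v) ts),
      list_prod A (map (\<lambda>(a, v, u). a \<otimes>\<^bsub>A\<^esub> u) ts)) | ts.
     length ts = n \<and> set ts \<subseteq> carrier A \<times> I \<times> I}"

lemma row_rel_mult:
  assumes A: "monoid A" and I: "I \<subseteq> carrier A"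
    and "(x, y) \<in> row_rel A I n" "(x', y') \<in> row_rel A I n'"
  shows "(x \<otimes>\<^bsub>A\<^esub> x', y \<otimes>\<^bsub>A\<^esub> y') \<in> row_rel A I (n + n')"
proof -
  interpret monoid A by (rule A)
  obtain ts ts' where ts: "length ts = n" "set ts \<subseteq> carrier A \<times> I \<times> I"
      "x = list_prod A (map (\<lambda>(a, v, u). a \<otimes>\<^bsub>A\<^esub> v) ts)" "y = list_prod A (map (\<lambda>(a, v, u). a \<otimes>\<^bsub>A\<^esub> u) ts)"
    and ts': "length ts' = n'" "set ts' \<subseteq> carrier A \<times> I \<times> I"
      "x' = list_prod A (map (\<lambda>(a, v, u). a \<otimes>\<^bsub>A\<^esub> v) ts')" "y' = list_prod A (map (\<lambda>(a, v, u). a \<otimes>\<^bsub>A\<^esub> u) ts')"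
    using assms(3,4) unfolding row_rel_def by blast
  have cl: "set (map (\<lambda>(a, v, u). a \<otimes>\<^bsub>A\<^esub> v) l) \<subseteq> carrier A" "set (map (\<lambda>(a, v, u). a \<otimes>\<^bsub>A\<^esub> u) l) \<subseteq> carrier A"
    if "set l \<subseteq> carrier A \<times> I \<times> I" for l
    using that I by fastforce+
  show ?thesis
    unfolding row_rel_def using ts ts' cl[OF ts(2)] cl[OF ts'(2)]
    by (auto intro!: exI[of _ "ts @ ts'"] simp: list_prod_append[OF A])
qed

lemma row_rel_one:
  assumes "monoid A" "\<one>\<^bsub>A\<^esub> \<in> I"
  shows "(\<one>\<^bsub>A\<^esub>, \<one>\<^bsub>A\<^esub>) \<in> row_rel A I n"
proof -
  interpret monoid A by (rule assms(1))
  have "list_prod A (replicate n \<one>\<^bsub>A\<^esub>) = \<one>\<^bsub>A\<^esub>" by (induction n) auto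
  then show ?thesis using assms(2)
    unfolding row_rel_def by (auto intro!: exI[of _ "replicate n (\<one>\<^bsub>A\<^esub>, \<one>\<^bsub>A\<^esub>, \<one>\<^bsub>A\<^esub>)"])
qed

lemma row_rel_carrier:
  assumes A: "monoid A" and I: "I \<subseteq> carrier A"
  shows "row_rel A I n \<subseteq> carrier A \<times> carrier A"
proof -
  interpret monoid A by (rule A)
  show ?thesis unfolding row_rel_def using I by (fastforce intro!: list_prod_closed[OF A])
qed

text \<open>Padding: a row is multiplied by a row of units of length \<open>n' - n\<close>, which
  leaves both products unchanged.\<close>

lemma row_rel_mono:
  assumes A: "monoid A" and I: "I \<subseteq> carrier A" "\<one>\<^bsub>A\<^esub> \<in> I" and "n \<le> n'"
  shows "row_rel A I n \<subseteq> row_rel A I n'"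
proof (rule subrelI)
  interpret monoid A by (rule A)
  fix x y assume xy: "(x, y) \<in> row_rel A I n"
  then have "x \<in> carrier A" "y \<in> carrier A" using row_rel_carrier[OF A I(1)] by auto
  then show "(x, y) \<in> row_rel A I n'"
    using row_rel_mult[OF A I(1) xy row_rel_one[OF A I(2), of "n' - n"]] \<open>n \<le> n'\<close> by simp
qed

text \<open>By minimality of the generated submonoid: rows of all lengths together are closed under
  products, by concatenation, and contain the generators.\<close>

lemma E_gen_row_rel:
  assumes A: "monoid A" and I: "I \<subseteq> carrier A" "\<one>\<^bsub>A\<^esub> \<in> I"
  shows "E_gen A I \<subseteq> (\<Union>n. row_rel A I n)"
proof (rule E_gen_subset)
  interpret monoid A by (rule A)
  show "submonoid (\<Union>n. row_rel A I n) (A \<times>\<times> A)"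
  proof
    show "(\<Union>n. row_rel A I n) \<subseteq> carrier (A \<times>\<times> A)" using row_rel_carrier[OF A I(1)] by auto
    show "\<one>\<^bsub>A \<times>\<times> A\<^esub> \<in> (\<Union>n. row_rel A I n)" using row_rel_one[OF A I(2)] by simp
    show "p \<otimes>\<^bsub>A \<times>\<times> A\<^esub> q \<in> (\<Union>n. row_rel A I n)"
      if "p \<in> (\<Union>n. row_rel A I n)" "q \<in> (\<Union>n. row_rel A I n)" for p q
      using that row_rel_mult[OF A I(1)] by (cases p; cases q) fastforce
  qed
  have "(a \<otimes>\<^bsub>A\<^esub> v, a \<otimes>\<^bsub>A\<^esub> u) \<in> row_rel A I 1" if "a \<in> carrier A" "v \<in> I" "u \<in> I" for a v u
    using that I unfolding row_rel_def by (auto intro!: exI[of _ "[(a, v, u)]"])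
  \<comment> \<open>With \<open>a = 1\<close> a one-entry row is an arbitrary pair in
    \<open>I \<times> I\<close>; with \<open>v = u = 1\<close> it is the diagonal pair of
    \<open>a\<close>.\<close>
  from this[of "\<one>\<^bsub>A\<^esub>"] this[of _ "\<one>\<^bsub>A\<^esub>" "\<one>\<^bsub>A\<^esub>"]
  have "I \<times> I \<union> Id_on (carrier A) \<subseteq> row_rel A I 1" using I by (fastforce simp: subset_iff)
  then show "I \<times> I \<union> Id_on (carrier A) \<subseteq> (\<Union>n. row_rel A I n)" by blast
qed

text \<open>A chain has finitely many steps, so the rows witnessing them can be padded to a common
  length.\<close>

lemma E_rel_row_rel:
  assumes A: "monoid A" and I: "I \<subseteq> carrier A" "\<one>\<^bsub>A\<^esub> \<in> I" and xy: "(x, y) \<in> E_rel A I"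
  obtains n where "n \<ge> 1" "(x, y) \<in> (row_rel A I n)\<^sup>+"
proof -
  note mono = row_rel_mono[OF A I]
  have "\<exists>n \<ge> 1. (x, y) \<in> (row_rel A I n)\<^sup>+"
    using xy unfolding E_rel_def
  proof (induction rule: trancl_induct)
    case (base y)
    then obtain n where "(x, y) \<in> row_rel A I n" using E_gen_row_rel[OF A I] by blast
    \<comment> \<open>The row may be empty, and one unit entry is added because (h) asks for
      positive lengths.\<close>
    then have "(x, y) \<in> row_rel A I (Suc n)" using mono[of n "Suc n"] by auto
    then show ?case by (intro exI[of _ "Suc n"]) auto
  next
    case (step y z)
    then obtain n where n: "n \<ge> 1" "(x, y) \<in> (row_rel A I n)\<^sup>+" by blast
    obtain n' where n': "(y, z) \<in> row_rel A I n'" using step(2) E_gen_row_rel[OF A I] by blast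
    \<comment> \<open>Both the chain so far and the new step are padded to length
      \<open>n + n'\<close>.\<close>
    have "(x, y) \<in> (row_rel A I (n + n'))\<^sup>+" using n(2) by (rule trancl_mono) (simp add: mono)
    moreover have "(y, z) \<in> row_rel A I (n + n')" using n' mono[of n' "n + n'"] by auto
    ultimately show ?case using n(1) by (intro exI[of _ "n + n'"]) (auto intro: trancl_into_trancl)
  qed
  then show ?thesis using that by blast
qed

text \<open>Translates between the columns of (h), counted from 1, and list positions, counted from
  0.\<close>

lemma row_sum_nth:
  assumes "length ts = n"
  shows "row_sum A n (\<lambda>i j. f (ts ! (j - 1))) (\<lambda>i j. g (ts ! (j - 1))) i = list_prod A (map (\<lambda>t. f t \<otimes>\<^bsub>A\<^esub> g t) ts)"
  unfolding row_sum_list_prod using assms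
  by (intro arg_cong[of _ _ "list_prod A"] nth_equalityI) (simp_all del: upt_Suc)

lemma zero_cls_E_rel_system:
  assumes A: "monoid A" and I: "I \<subseteq> carrier A" "\<one>\<^bsub>A\<^esub> \<in> I" and x: "(\<one>\<^bsub>A\<^esub>, x) \<in> E_rel A I"
  obtains k n a u v where "k \<ge> 1" "n \<ge> 1"
    "\<forall>i \<in> {1..k}. \<forall>j \<in> {1..n}. a i j \<in> carrier A \<and> u i j \<in> I \<and> v i j \<in> I"
    "\<one>\<^bsub>A\<^esub> = row_sum A n a v 1"
    "\<forall>i \<in> {2..k}. row_sum A n a u (i - 1) = row_sum A n a v i"
    "x = row_sum A n a u k"
proof -
  obtain n where n: "n \<ge> 1" "(\<one>\<^bsub>A\<^esub>, x) \<in> (row_rel A I n)\<^sup>+" using E_rel_row_rel[OF A I x] by blast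
  \<comment> \<open>The transitive closure is unfolded into a chain \<open>c 0, ..., c k\<close> of
    positive length.\<close>
  then obtain k c where k: "k > 0" and c: "c 0 = \<one>\<^bsub>A\<^esub>" "c k = x"
    and step: "\<And>i. i < k \<Longrightarrow> (c i, c (Suc i)) \<in> row_rel A I n"
    by (auto simp: trancl_power relpow_fun_conv)
  \<comment> \<open>Row \<open>i\<close> witnesses the step from \<open>c (i - 1)\<close> to
    \<open>c i\<close>. The range condition on \<open>i\<close> stands under the quantifier so that
    choice gives a total function \<open>t\<close>.\<close>
  have "\<exists>ts. i \<in> {1..k} \<longrightarrow> length ts = n \<and> set ts \<subseteq> carrier A \<times> I \<times> I \<and>
      c (i - 1) = list_prod A (map (\<lambda>(a, v, u). a \<otimes>\<^bsub>A\<^esub> v) ts) \<and>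
      c i = list_prod A (map (\<lambda>(a, v, u). a \<otimes>\<^bsub>A\<^esub> u) ts)" for i
    using step[of "i - 1"] unfolding row_rel_def by (cases i) auto
  then obtain t where t: "\<And>i. i \<in> {1..k} \<Longrightarrow> length (t i) = n \<and> set (t i) \<subseteq> carrier A \<times> I \<times> I \<and>
      c (i - 1) = list_prod A (map (\<lambda>(a, v, u). a \<otimes>\<^bsub>A\<^esub> v) (t i)) \<and>
      c i = list_prod A (map (\<lambda>(a, v, u). a \<otimes>\<^bsub>A\<^esub> u) (t i))" by metis
  define a where "a = (\<lambda>i j. fst (t i ! (j - 1)))"
  define v where "v = (\<lambda>i j. fst (snd (t i ! (j - 1))))"
  define u where "u = (\<lambda>i j. snd (snd (t i ! (j - 1))))"
  \<comment> \<open>Consecutive rows thus meet in a common chain element, which gives the equations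
    of (h).\<close>
  have v_sum: "row_sum A n a v i = c (i - 1)" and u_sum: "row_sum A n a u i = c i" if "i \<in> {1..k}" for i
    using t[OF that] row_sum_nth[of "t i" n A fst "\<lambda>p. fst (snd p)" i]
      row_sum_nth[of "t i" n A fst "\<lambda>p. snd (snd p)" i]
    by (simp_all add: a_def v_def u_def row_sum_def case_prod_unfold)
  have mem: "a i j \<in> carrier A \<and> u i j \<in> I \<and> v i j \<in> I" if "i \<in> {1..k}" "j \<in> {1..n}" for i j
  proof -
    have "t i ! (j - 1) \<in> set (t i)" using t[OF that(1)] that(2) by (intro nth_mem) auto
    then show ?thesis using t[OF that(1)] by (auto simp: a_def u_def v_def)
  qed
  show thesis
  proof (rule that)
    show "\<forall>i \<in> {2..k}. row_sum A n a u (i - 1) = row_sum A n a v i"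
    proof
      fix i assume "i \<in> {2..k}"
      then have "i \<in> {1..k}" "i - 1 \<in> {1..k}" by auto
      then show "row_sum A n a u (i - 1) = row_sum A n a v i" using u_sum v_sum by simp
    qed
    show "\<one>\<^bsub>A\<^esub> = row_sum A n a v 1" using v_sum[of 1] c k by simp
    show "x = row_sum A n a u k" using u_sum[of k] c k by simp
  qed (use n k mem in auto)
qed

text \<open>All \<open>u\<close> and \<open>v\<close> entries are congruent to \<open>1\<close>,
  hence to each other, so the two sums of a row are congruent. The equations join the rows into a
  chain starting at \<open>1\<close>.\<close>

lemma system_in_zero_cls:
  assumes A: "monoid A" and S: "congruence A S" and "k \<ge> 1"
    and mem: "\<And>i j. i \<in> {1..k} \<Longrightarrow> j \<in> {1..n} \<Longrightarrow> a i j \<in> carrier A \<and> u i j \<in> zero_cls A S \<and> v i j \<in> zero_cls A S"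
    and one: "\<one>\<^bsub>A\<^esub> = row_sum A n a v 1"
    and eqs: "\<And>i. i \<in> {2..k} \<Longrightarrow> row_sum A n a u (i - 1) = row_sum A n a v i"
  shows "row_sum A n a u k \<in> zero_cls A S"
proof -
  have row: "(row_sum A n a v i, row_sum A n a u i) \<in> S" if i: "i \<in> {1..k}" for i
  proof (rule row_sum_congruent[OF S])
    fix j assume j: "j \<in> {1..n}"
    show "a i j \<in> carrier A" using mem[OF i j] by simp
    have "(\<one>\<^bsub>A\<^esub>, v i j) \<in> S" "(\<one>\<^bsub>A\<^esub>, u i j) \<in> S" using mem[OF i j] by (simp_all add: zero_cls_def)
    then show "(v i j, u i j) \<in> S" using congruence_trans[OF S] congruence_sym[OF S] by blast
  qed
  have "(\<one>\<^bsub>A\<^esub>, row_sum A n a u i) \<in> S" if "1 \<le> i" "i \<le> k" for i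
    using that
  proof (induction i rule: dec_induct)
    case base
    then show ?case using row[of 1] one by simp
  next
    case (step i)
    then have "(\<one>\<^bsub>A\<^esub>, row_sum A n a v (Suc i)) \<in> S" using eqs[of "Suc i"] by simp
    moreover have "(row_sum A n a v (Suc i), row_sum A n a u (Suc i)) \<in> S" using row step by simp
    ultimately show ?case by (rule congruence_trans[OF S])
  qed
  from this[OF \<open>k \<ge> 1\<close>] show ?thesis
    using congruence_carrier(2)[OF S] by (simp add: zero_cls_def)
qed

section \<open>Equivalence of the eight conditions\<close>

theorem theorem2:
  fixes A :: "'a monoid" and M :: "'b monoid" and m :: "'b \<Rightarrow> 'a" and I :: "'a set"
  assumes "monoid A" and "monoid M" and "monoid_mono M A m"
    and I: "I = m ` carrier M"
  shows "(normal_mono M A m \<longleftrightarrow> (\<exists>S. congruence A S \<and> I = zero_cls A S))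
    \<and> (normal_mono M A m \<longleftrightarrow> I = zero_cls A (syntactic_congruence A I))
    \<and> (normal_mono M A m \<longleftrightarrow> I = zero_cls A (E_rel A I))
    \<and> (normal_mono M A m \<longleftrightarrow> I = zero_cls A (LEAST S. congruence A S \<and> I \<subseteq> zero_cls A S))
    \<and> (normal_mono M A m \<longleftrightarrow> (M, A, m) \<in> Fix_eta)
    \<and> (normal_mono M A m \<longleftrightarrow> E_ob (M, A, m) \<in> Fix_eps \<and> I = zero_cls A (snd (E_ob (M, A, m))))
    \<and> (normal_mono M A m \<longleftrightarrow>
        (\<forall>x \<in> carrier A. \<forall>y \<in> carrier A. \<forall>u \<in> I.
          x \<otimes>\<^bsub>A\<^esub> y \<in> I \<longleftrightarrow> x \<otimes>\<^bsub>A\<^esub> u \<otimes>\<^bsub>A\<^esub> y \<in> I))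
    \<and> (normal_mono M A m \<longleftrightarrow>
        (\<forall>k \<ge> 1. \<forall>n \<ge> 1. \<forall>a u v.
          (\<forall>i \<in> {1..k}. \<forall>j \<in> {1..n}. a i j \<in> carrier A \<and> u i j \<in> I \<and> v i j \<in> I) \<longrightarrow>
          \<one>\<^bsub>A\<^esub> = row_sum A n a v 1 \<longrightarrow>
          (\<forall>i \<in> {2..k}. row_sum A n a u (i - 1) = row_sum A n a v i) \<longrightarrow>
          row_sum A n a u k \<in> I))"
proof -
  note A = assms(1) and M = assms(2) and m = assms(3)
  have sub: "I \<subseteq> carrier A" "\<one>\<^bsub>A\<^esub> \<in> I" using monoid_mono_image[OF M m] I by auto
  let ?a = "\<exists>S. congruence A S \<and> I = zero_cls A S"
  let ?b = "I = zero_cls A (syntactic_congruence A I)"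
  let ?c = "I = zero_cls A (E_rel A I)"
  let ?g = "\<forall>x \<in> carrier A. \<forall>y \<in> carrier A. \<forall>u \<in> I.
          x \<otimes>\<^bsub>A\<^esub> y \<in> I \<longleftrightarrow> x \<otimes>\<^bsub>A\<^esub> u \<otimes>\<^bsub>A\<^esub> y \<in> I"
  let ?h = "\<forall>k \<ge> 1. \<forall>n \<ge> 1. \<forall>a u v.
          (\<forall>i \<in> {1..k}. \<forall>j \<in> {1..n}. a i j \<in> carrier A \<and> u i j \<in> I \<and> v i j \<in> I) \<longrightarrow>
          \<one>\<^bsub>A\<^esub> = row_sum A n a v 1 \<longrightarrow>
          (\<forall>i \<in> {2..k}. row_sum A n a u (i - 1) = row_sum A n a v i) \<longrightarrow>
          row_sum A n a u k \<in> I"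
  \<comment> \<open>Condition (a) is the hub: it is equivalent to normality and to (c); (b) gives
    (a), (a) gives (g), and (g) is (b); (a) gives (h), and (h) gives (c).\<close>
  have na: "normal_mono M A m \<longleftrightarrow> ?a" using normal_mono_iff_zero_cls[OF A M m] I by simp
  have ca: "?c \<longleftrightarrow> ?a" by (rule zero_cls_E_rel[OF A sub])
  have bg: "?b \<longleftrightarrow> ?g" by (rule zero_cls_syntactic_congruence[OF A sub])
  have ba: "?a" if ?b using that syntactic_congruence_congruence[OF A] by blast
  have ag: "?g" if ?a
  proof -
    obtain S where "congruence A S" "I = zero_cls A S" using \<open>?a\<close> by blast
    then show ?thesis using zero_cls_cancel[OF A] by blast
  qed
  have ah: "?h" if ?a
  proof -
    obtain S where S: "congruence A S" "I = zero_cls A S" using \<open>?a\<close> by blast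
    show ?thesis unfolding S(2) by (intro allI impI system_in_zero_cls[OF A S(1)]) auto
  qed
  have hc: "?c" if ?h
  proof
    show "I \<subseteq> zero_cls A (E_rel A I)" by (rule E_rel_zero_cls[OF sub])
    show "zero_cls A (E_rel A I) \<subseteq> I"
    proof
      fix x assume "x \<in> zero_cls A (E_rel A I)"
      then have "(\<one>\<^bsub>A\<^esub>, x) \<in> E_rel A I" by (simp add: zero_cls_def)
      then show "x \<in> I"
      proof (rule zero_cls_E_rel_system[OF A sub])
        fix k n a u v
        assume "k \<ge> 1" "n \<ge> 1"
          and "\<forall>i \<in> {1..k}. \<forall>j \<in> {1..n}. a i j \<in> carrier A \<and> u i j \<in> I \<and> v i j \<in> I"
          and "\<one>\<^bsub>A\<^esub> = row_sum A n a v 1"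
          and "\<forall>i \<in> {2..k}. row_sum A n a u (i - 1) = row_sum A n a v i"
          and x: "x = row_sum A n a u k"
        then show "x \<in> I" unfolding x using \<open>?h\<close>[rule_format, of k n a u v] by blast
      qed
    qed
  qed
  \<comment> \<open>The membership half of (f); by \<open>s\<close> the other half is (c).\<close>
  have f: "E_ob (M, A, m) \<in> Fix_eps"
    using A M m by (intro E_ob_in_Fix_eps) (simp add: mono_obj_def)
  have e: "(M, A, m) \<in> Fix_eta \<longleftrightarrow> ?c" using Fix_eta_iff_zero_cls[OF A M m] I by simp
  have s: "snd (E_ob (M, A, m)) = E_rel A I" by (simp add: E_ob_def I)
  have h: "normal_mono M A m \<longleftrightarrow> ?h" using na ca ah hc by blast
  have g: "normal_mono M A m \<longleftrightarrow> ?g" using na ag ba bg by blast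
  show ?thesis
    unfolding Least_congruence[OF A sub] s
    using na ca bg e f by (intro conjI g h) (use g in simp_all)
qed

end
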